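(* Let $d,n$ be positive integers. There exist $\varepsilon>0$ and a compact set $K \subset \mathbb{R}^d$ such that for any $n$ points in $K$ there is a set $X \subset K$ of volume $1$ such that every point of $X$ sees each of the $n$ given points, but there does not exist a set $X' \subset K$ of volume larger than $1-\varepsilon$ such that each point of $X'$ sees every point of $K$.
   Context: For $K \subset \mathbb{R}^d$ and $x,y \in K$, we say $x$ sees $y$ (in $K$) if the closed segment $[x,y]$ is contained in $K$. Volume means $d$-dimensional Lebesgue measure. *)

theory Defs
  imports "HOL-Analysis.Analysis"
begin

(* The inclusion already forces both endpoints to lie in K. *)
definition sees :: "(real ^ 'd) set \<Rightarrow> real ^ 'd \<Rightarrow> real ^ 'd \<Rightarrow> bool" where
  "sees K x y \<longleftrightarrow> closed_segment x y \<subseteq> K"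

end

theory Submission
  imports Defs
begin

text \<open>In the plane, take the tangent half-planes \<open>y \<ge> 2 k x - k\<^sup>2\<close> of the parabola \<open>y = x\<^sup>2\<close>
  for \<open>k = 1, \<dots>, N\<close>, and let \<open>K\<close> be the set of points of a large ball that violate at most one of
  these constraints; in higher dimension only two of the coordinates are constrained. By convexity
  of \<open>k \<mapsto> k\<^sup>2\<close>, the constraints violated at a point form an interval of indices. Hence a point
  violating only \<open>i\<close> and a point violating only \<open>j\<close> see each other whenever \<open>\<bar>i - j\<bar> \<ge> 2\<close>, because
  a point between them violates a subset of \<open>{i, j}\<close>, which cannot be all of \<open>{i, j}\<close>. So for \<open>n\<close>
  given points and \<open>N > 3 n\<close> some \<open>m\<close> is far from all indices they violate, and they all see every
  point violating at most \<open>m\<close>. On the other hand a point violating \<open>j\<close> does not see the point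
  \<open>(m, m\<^sup>2 - 1)\<close> for \<open>m = j \<plusminus> 1\<close>, which violates only \<open>m\<close> and is tight for \<open>j\<close>. The kernel is thus
  contained in the set of points violating nothing, whose volume is strictly smaller. Rescaling
  makes the smallest of the volumes of the \<open>N\<close> larger sets equal to 1.

  This needs \<open>d \<ge> 2\<close>. For \<open>d = 1\<close> two disjoint unit intervals serve when \<open>n = 1\<close>, and for
  \<open>n \<ge> 2\<close> only the empty set does, for which the condition on \<open>n\<close> points is vacuous.\<close>

section \<open>Tangent half-planes of the parabola and the regions they cut out\<close>

definition slack :: "'d \<Rightarrow> 'd \<Rightarrow> nat \<Rightarrow> real ^ 'd \<Rightarrow> real" where
  "slack a b k x = x $ b - 2 * real k * x $ a + (real k)\<^sup>2"

definition feasible :: "'d::finite \<Rightarrow> 'd \<Rightarrow> real \<Rightarrow> nat set \<Rightarrow> (real ^ 'd) set" where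
  "feasible a b R A = cball 0 R \<inter> (\<Inter>k\<in>A. {x. 0 \<le> slack a b k x})"

text \<open>The union form makes compactness immediate for finite \<open>I\<close> and equips each
  point with an index \<open>m\<close> that it is allowed to violate.\<close>

definition almost_feasible :: "'d::finite \<Rightarrow> 'd \<Rightarrow> real \<Rightarrow> nat set \<Rightarrow> (real ^ 'd) set" where
  "almost_feasible a b R I = (\<Union>m\<in>I. feasible a b R (I - {m}))"

text \<open>Depth \<open>t\<close> is measured down from the point of tangency of index
  \<open>m\<close>. At \<open>t = 1\<close> the point lies on the tangents of the neighbouring
  indices; at \<open>t = 1/2\<close> it lies strictly above every tangent but its own.\<close>

definition tip :: "'d::finite \<Rightarrow> 'd \<Rightarrow> nat \<Rightarrow> real \<Rightarrow> real ^ 'd" where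
  "tip a b m t = (\<chi> i. if i = a then real m else if i = b then (real m)\<^sup>2 - t else 0)"

lemma slack_convex_combination:
  assumes "u + v = 1"
  shows "slack a b k (u *\<^sub>R x + v *\<^sub>R y) = u * slack a b k x + v * slack a b k y"
proof -
  have u: "u = 1 - v" using assms by simp
  show ?thesis unfolding slack_def u by (simp add: algebra_simps)
qed

lemma slack_between:
  assumes "slack a b i x < 0" "slack a b j x < 0" "i < k" "k < j"
  shows "slack a b k x < 0"
proof -
  define p q where "p = real k - real i" and "q = real j - real k"
  have pq: "p > 0" "q > 0" using assms by (auto simp: p_def q_def)
  \<comment> \<open>The index \<open>k\<close> is the mean of \<open>i\<close> and \<open>j\<close>
    with weights \<open>q\<close> and \<open>p\<close>. The slack is affine in the index up to the
    square term, and the mean of the squares exceeds the square of \<open>k\<close> by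
    \<open>p * q\<close>.\<close>
  have "q * slack a b i x + p * slack a b j x = (p + q) * (slack a b k x + p * q)"
    unfolding slack_def p_def q_def by (simp add: algebra_simps power2_eq_square)
  moreover have "q * slack a b i x + p * slack a b j x < 0"
    using assms pq by (simp add: add_neg_neg mult_pos_neg)
  ultimately have "slack a b k x + p * q < 0"
    using pq by (simp add: mult_less_0_iff)
  moreover have "p * q > 0" using pq by simp
  ultimately show ?thesis by linarith
qed

lemma slack_tip:
  assumes "a \<noteq> b"
  shows "slack a b k (tip a b m t) = (real k - real m)\<^sup>2 - t"
  using assms by (simp add: slack_def tip_def power2_eq_square algebra_simps)

lemma real_diff_square_ge_1:
  assumes "k \<noteq> m"
  shows "(real k - real m)\<^sup>2 \<ge> 1"
proof -
  have "\<bar>real k - real m\<bar> \<ge> 1" using assms by linarith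
  then show ?thesis using power_mono[of 1 "\<bar>real k - real m\<bar>" 2] by simp
qed

lemma continuous_on_slack: "continuous_on S (slack a b k)"
  unfolding slack_def by (intro continuous_intros)

lemma closed_slack_ge: "closed {x. 0 \<le> slack a b k x}"
  by (intro closed_Collect_le continuous_on_slack continuous_on_const)

lemma compact_feasible: "compact (feasible a b R A)"
  unfolding feasible_def by (intro compact_Int_closed compact_cball closed_INT ballI closed_slack_ge)

lemma compact_almost_feasible: "finite I \<Longrightarrow> compact (almost_feasible a b R I)"
  unfolding almost_feasible_def by (intro compact_UN compact_feasible)

lemma convex_feasible: "convex (feasible a b R A)"
proof -
  have "convex {x. 0 \<le> slack a b k x}" for k
    by (rule convexI) (simp add: slack_convex_combination)
  then show ?thesis unfolding feasible_def by (intro convex_Int convex_cball convex_INT)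
qed

lemma zero_in_feasible: "R \<ge> 0 \<Longrightarrow> 0 \<in> feasible a b R A"
  by (simp add: feasible_def slack_def)

lemma feasible_antimono: "A \<subseteq> B \<Longrightarrow> feasible a b R B \<subseteq> feasible a b R A"
  by (auto simp: feasible_def)

text \<open>Star-shapedness about the origin. It keeps a smaller dilate inside a larger one when
  regions of different volumes are normalized.\<close>

lemma feasible_scaleR_mem:
  assumes "x \<in> feasible a b R A" "0 \<le> c" "c \<le> 1"
  shows "c *\<^sub>R x \<in> feasible a b R A"
proof -
  have "R \<ge> 0" using assms(1) order_trans[OF norm_ge_zero[of x]] by (simp add: feasible_def)
  then show ?thesis
    using convexD[OF convex_feasible assms(1) zero_in_feasible, of c "1 - c"] assms(2,3) by simp
qed

section \<open>Visibility between points that violate distant constraints\<close>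

lemma feasible_sees:
  assumes "m \<in> {1..N}" "j \<in> {1..N}" "Suc m < j \<or> Suc j < m"
    and "x \<in> feasible a b R ({1..N} - {m})" "p \<in> feasible a b R ({1..N} - {j})"
  shows "sees (almost_feasible a b R {1..N}) x p"
  unfolding sees_def
proof
  let ?I = "{1..N}"
  fix z assume z: "z \<in> closed_segment x p"
  have "x \<in> feasible a b R (?I - {m, j})" "p \<in> feasible a b R (?I - {m, j})"
    using assms(4,5) unfolding feasible_def by blast+
  then have zf: "z \<in> feasible a b R (?I - {m, j})"
    using z closed_segment_subset[OF _ _ convex_feasible] by blast
  have "0 \<le> slack a b m z \<or> 0 \<le> slack a b j z"
  proof (rule ccontr)
    assume "\<not> ?thesis"
    then have neg: "slack a b m z < 0" "slack a b j z < 0" by simp_all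
    \<comment> \<open>The gap leaves an index strictly between \<open>m\<close> and
      \<open>j\<close>. Violating both would force a violation there, where \<open>z\<close> is
      known to be feasible.\<close>
    obtain i where i: "i \<in> ?I" "m < i \<and> i < j \<or> j < i \<and> i < m"
    proof (cases "Suc m < j")
      case True
      then show ?thesis using that[of "Suc m"] assms(1,2) by simp
    next
      case False
      then show ?thesis using that[of "Suc j"] assms by simp
    qed
    have "slack a b i z < 0"
      using i(2) slack_between[OF neg] slack_between[OF neg(2,1)] by blast
    moreover have "i \<in> ?I - {m, j}" using i by blast
    then have "0 \<le> slack a b i z" using zf unfolding feasible_def by blast
    ultimately show False by linarith
  qed
  then have "z \<in> feasible a b R (?I - {m}) \<or> z \<in> feasible a b R (?I - {j})"
    using zf unfolding feasible_def by blast
  then show "z \<in> almost_feasible a b R ?I"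
    using assms(1,2) unfolding almost_feasible_def by blast
qed

text \<open>Pigeonhole: each \<open>j\<close> rules out at most three indices (for
  \<open>j = 0\<close> the subtraction truncates and leaves two), so at most \<open>3 * n\<close> of
  the \<open>3 * n + 1\<close> candidates are lost.\<close>

lemma exists_separated_index:
  assumes "finite S" "card S \<le> n"
  shows "\<exists>m\<in>{1..3 * n + 1}. \<forall>j\<in>S. Suc m < j \<or> Suc j < m"
proof -
  let ?T = "\<Union>j\<in>S. {j - 1..j + 1}"
  have "card ?T \<le> (\<Sum>j\<in>S. card {j - 1..j + 1})" by (rule card_UN_le[OF assms(1)])
  also have "\<dots> \<le> card S * 3"
    using sum_bounded_above[of S "\<lambda>j. card {j - 1..j + 1}" 3] by simp
  finally have "card ?T < card {1..3 * n + 1}" using assms(2) by simp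
  moreover have "finite ?T" using assms(1) by simp
  ultimately have "\<not> {1..3 * n + 1} \<subseteq> ?T"
    using card_mono[of ?T "{1..3 * n + 1}"] by linarith
  then obtain m where m: "m \<in> {1..3 * n + 1}" "m \<notin> ?T" by blast
  have "Suc m < j \<or> Suc j < m" if "j \<in> S" for j
  proof -
    have "m \<notin> {j - 1..j + 1}" using m(2) that by blast
    then show ?thesis unfolding atLeastAtMost_iff by linarith
  qed
  then show ?thesis using m(1) by blast
qed

lemma almost_feasible_common_view:
  fixes p :: "nat \<Rightarrow> real ^ 'd"
  assumes p: "\<forall>i<n. p i \<in> almost_feasible a b R {1..3 * n + 1}"
  shows "\<exists>m\<in>{1..3 * n + 1}. \<forall>x\<in>feasible a b R ({1..3 * n + 1} - {m}).
           \<forall>i<n. sees (almost_feasible a b R {1..3 * n + 1}) x (p i)"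
proof -
  let ?I = "{1..3 * n + 1}"
  have "\<forall>i\<in>{..<n}. \<exists>j. j \<in> ?I \<and> p i \<in> feasible a b R (?I - {j})"
    using p unfolding almost_feasible_def by blast
  then obtain j where j: "\<And>i. i < n \<Longrightarrow> j i \<in> ?I \<and> p i \<in> feasible a b R (?I - {j i})"
    unfolding bchoice_iff by blast
  have "card (j ` {..<n}) \<le> n" using card_image_le[of "{..<n}" j] by simp
  then obtain m where m: "m \<in> ?I" "\<forall>k\<in>j ` {..<n}. Suc m < k \<or> Suc k < m"
    using exists_separated_index[of "j ` {..<n}" n] by blast
  then show ?thesis using feasible_sees[OF m(1)] j by blast
qed

section \<open>The kernel violates nothing\<close>

lemma violating_not_sees_tip:
  assumes "a \<noteq> b" "j \<in> I" "m \<in> I" "m = Suc j \<or> j = Suc m" "slack a b j x < 0"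
  shows "\<not> sees (almost_feasible a b R I) x (tip a b m 1)"
proof
  assume s: "sees (almost_feasible a b R I) x (tip a b m 1)"
  \<comment> \<open>Constraint \<open>j\<close> is tight at the tip, so it stays violated all the
    way up to it, while \<open>m\<close> has slack \<open>-1\<close> at the tip and is violated
    nearby. The weight \<open>u\<close> brings \<open>z\<close> close enough: its slack for
    \<open>m\<close> is \<open>(slack a b m x - c) / (c + 1)\<close>, and \<open>c\<close> exceeds
    \<open>slack a b m x\<close>.\<close>
  define c where "c = \<bar>slack a b m x\<bar> + 1"
  define u where "u = c / (c + 1)"
  define z where "z = (1 - u) *\<^sub>R x + u *\<^sub>R tip a b m 1"
  have c: "c \<ge> 1" by (simp add: c_def)
  have u: "0 \<le> u" "u < 1" "1 - u = 1 / (c + 1)" using c by (auto simp: u_def field_simps)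
  have "z \<in> closed_segment x (tip a b m 1)"
    using u by (auto simp: closed_segment_def z_def intro!: exI[of _ u])
  then have "z \<in> almost_feasible a b R I" using s by (auto simp: sees_def)
  then obtain i where "\<forall>k\<in>I - {i}. 0 \<le> slack a b k z"
    by (auto simp: almost_feasible_def feasible_def)
  then have "0 \<le> slack a b j z \<or> 0 \<le> slack a b m z"
    using assms(2-4) by (cases "i = j") auto
  moreover have "slack a b j z = (1 - u) * slack a b j x"
    using assms(4) by (auto simp: z_def slack_convex_combination slack_tip[OF assms(1)])
  then have "slack a b j z < 0" using u(2) assms(5) by (simp add: mult_pos_neg)
  moreover have "slack a b m z = (slack a b m x - c) / (c + 1)"
    unfolding z_def using c u(3)
    by (simp add: slack_convex_combination slack_tip[OF assms(1)])
      (simp add: u_def diff_divide_distrib)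
  then have "slack a b m z < 0"
    using c by (simp add: c_def divide_neg_pos)
  ultimately show False by linarith
qed

lemma tip_in_feasible:
  assumes "a \<noteq> b" "norm (tip a b m t) \<le> R" "t \<le> 1"
  shows "tip a b m t \<in> feasible a b R (I - {m})"
proof -
  have "0 \<le> slack a b k (tip a b m t)" if "k \<noteq> m" for k
    using real_diff_square_ge_1[OF that] assms by (simp add: slack_tip)
  then show ?thesis using assms by (auto simp: feasible_def)
qed

text \<open>As \<open>N \<ge> 2\<close>, a violated index has a neighbour in the range, and the tip
  of that neighbour is a point of the body hidden from \<open>x\<close>.\<close>

lemma kernel_subset_feasible:
  assumes "a \<noteq> b" "N \<ge> 2" and R: "\<And>m. m \<in> {1..N} \<Longrightarrow> norm (tip a b m 1) \<le> R"
    and x: "x \<in> almost_feasible a b R {1..N}"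
    and "\<forall>y\<in>almost_feasible a b R {1..N}. sees (almost_feasible a b R {1..N}) x y"
  shows "x \<in> feasible a b R {1..N}"
proof (rule ccontr)
  assume "x \<notin> feasible a b R {1..N}"
  then obtain j where j: "j \<in> {1..N}" "slack a b j x < 0"
    using x by (auto simp: feasible_def almost_feasible_def not_le)
  obtain m where m: "m \<in> {1..N}" "m = Suc j \<or> j = Suc m"
  proof (cases "j = N")
    case True
    then show ?thesis using assms(2) that[of "N - 1"] by auto
  next
    case False
    then show ?thesis using j that[of "Suc j"] by auto
  qed
  have "tip a b m 1 \<in> almost_feasible a b R {1..N}"
    using tip_in_feasible[OF assms(1) R[OF m(1)]] m(1) unfolding almost_feasible_def by blast
  then show False
    using assms(5) violating_not_sees_tip[OF assms(1) j(1) m j(2)] by blast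
qed

section \<open>Volumes and scaling\<close>

lemma measure_feasible_less:
  assumes "a \<noteq> b" "finite I" "m \<in> I" "norm (tip a b m (1/2)) < R"
  shows "measure lebesgue (feasible a b R I) < measure lebesgue (feasible a b R (I - {m}))"
proof -
  let ?P = "feasible a b R I" and ?Q = "feasible a b R (I - {m})"
  \<comment> \<open>An open part of the difference. Depth \<open>1/2\<close> makes every inequality
    strict at the tip, so this set is nonempty and has positive volume.\<close>
  let ?U = "ball 0 R \<inter> {x. slack a b m x < 0} \<inter> (\<Inter>k\<in>I - {m}. {x. 0 < slack a b k x})"
  have meas: "?P \<in> lmeasurable" "?Q \<in> lmeasurable"
    by (auto intro: lmeasurable_compact compact_feasible)
  have sub: "?P \<subseteq> ?Q" by (rule feasible_antimono) auto
  have "open ?U"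
    using assms(2)
    by (intro open_Int open_ball open_INT ballI open_Collect_less continuous_on_slack
        continuous_on_const) auto
  moreover have "0 < slack a b k (tip a b m (1/2))" if "k \<noteq> m" for k
    using real_diff_square_ge_1[OF that] assms(1) by (simp add: slack_tip)
  then have "tip a b m (1/2) \<in> ?U"
    using assms(1,4) by (auto simp: slack_tip)
  ultimately have "\<not> negligible ?U" using open_not_negligible by blast
  moreover have "?U \<subseteq> ?Q - ?P"
  proof
    fix x assume x: "x \<in> ?U"
    then have "x \<in> ?Q" by (simp add: feasible_def less_imp_le)
    moreover have "x \<notin> ?P" using x assms(3) by (fastforce simp: feasible_def)
    ultimately show "x \<in> ?Q - ?P" by blast
  qed
  ultimately have "\<not> negligible (?Q - ?P)" using negligible_subset by blast
  moreover have QP: "?Q - ?P \<in> lmeasurable" using meas by (rule fmeasurable.Diff[rotated])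
  ultimately have "measure lebesgue (?Q - ?P) > 0"
    using negligible_iff_measure[of "?Q - ?P"] by (simp add: zero_less_measure_iff)
  then show ?thesis using measurable_measure_Diff[OF meas(2) _ sub] meas(1) by auto
qed

lemma sees_scaleR:
  assumes "s \<noteq> 0"
  shows "sees ((*\<^sub>R) s ` K) (s *\<^sub>R x) (s *\<^sub>R y) \<longleftrightarrow> sees K x y"
proof -
  have "closed_segment (s *\<^sub>R x) (s *\<^sub>R y) = (*\<^sub>R) s ` closed_segment x y"
    by (rule closed_segment_linear_image) (simp add: linear_scaleR)
  then show ?thesis using assms by (simp add: sees_def inj_image_subset_iff inj_on_def)
qed

lemma measure_scaleR_image:
  fixes S :: "(real ^ 'd) set"
  assumes "0 \<le> r"
  shows "measure lebesgue ((*\<^sub>R) r ` S) = r ^ CARD('d) * measure lebesgue S"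
  using measure_lebesgue_affine[of r 0 S] assms by simp

section \<open>Normalization when two distinct coordinates exist\<close>

lemma exists_volume_gap:
  assumes ab: "(a :: 'd::finite) \<noteq> b" and n: "n \<ge> 1"
  shows "\<exists>(\<epsilon>::real) (K :: (real ^ 'd) set).
           \<epsilon> > 0 \<and> compact K \<and> K \<noteq> {} \<and>
           (\<forall>p :: nat \<Rightarrow> real ^ 'd. (\<forall>i<n. p i \<in> K) \<longrightarrow>
              (\<exists>X. X \<subseteq> K \<and> X \<in> lmeasurable \<and> measure lebesgue X = 1 \<and>
                   (\<forall>x\<in>X. \<forall>i<n. sees K x (p i)))) \<and>
           \<not> (\<exists>X'. X' \<subseteq> K \<and> X' \<in> lmeasurable \<and> measure lebesgue X' > 1 - \<epsilon> \<and>
                   (\<forall>x\<in>X'. \<forall>y\<in>K. sees K x y))"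
proof -
  define I where "I = {1..3 * n + 1}"
  have I: "finite I" "I \<noteq> {}" by (auto simp: I_def)
  define R where "R = 1 + (\<Sum>m\<in>I. norm (tip a b m 1) + norm (tip a b m (1/2)))"
  \<comment> \<open>The summand 1 in \<open>R\<close> puts the tips of depth \<open>1/2\<close> in
    the open ball.\<close>
  have R_ge: "norm (tip a b m 1) + norm (tip a b m (1/2)) \<le> R - 1" if "m \<in> I" for m
    using member_le_sum[OF that, of "\<lambda>m. norm (tip a b m 1) + norm (tip a b m (1/2))"] I
    by (simp add: R_def)
  have R: "norm (tip a b m 1) \<le> R \<and> norm (tip a b m (1/2)) < R" if "m \<in> I" for m
    using norm_ge_zero[of "tip a b m 1"] norm_ge_zero[of "tip a b m (1/2)"] R_ge[OF that]
    by linarith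
  have "R \<ge> 0" by (auto simp: R_def intro!: add_nonneg_nonneg sum_nonneg)
  define P K where "P = feasible a b R I" and "K = almost_feasible a b R I"
  define Q where "Q m = feasible a b R (I - {m})" for m
  have comp: "compact P" "compact (Q m)" for m
    by (simp_all add: P_def Q_def compact_feasible)
  \<comment> \<open>The minimum is the volume scaled to 1, so that no \<open>Q m\<close> ends up
    with less. It is attained, hence strictly above \<open>v\<close>.\<close>
  define v \<mu> where "v = measure lebesgue P" and "\<mu> = Min ((\<lambda>m. measure lebesgue (Q m)) ` I)"
  have v: "0 \<le> v" by (simp add: v_def)
  have "v < \<mu>"
    using I R measure_feasible_less[OF ab I(1)] by (simp add: \<mu>_def v_def P_def Q_def)
  with v have \<mu>: "0 < \<mu>" by linarith
  have Q_ge: "\<mu> \<le> measure lebesgue (Q m)" if "m \<in> I" for m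
    using that I by (simp add: \<mu>_def)
  define s where "s = root CARD('d) (1 / \<mu>)"
  have s: "s > 0" "s ^ CARD('d) = 1 / \<mu>"
    using \<mu> by (simp_all add: s_def real_root_gt_zero)
  show ?thesis
  proof (rule exI, rule exI, intro conjI allI impI)
    \<comment> \<open>After scaling by \<open>s\<close>, the set \<open>P\<close> containing the
      kernel has volume \<open>v / \<mu>\<close>.\<close>
    show "1 - v / \<mu> > 0" using \<open>v < \<mu>\<close> \<mu> by simp
    show "compact ((*\<^sub>R) s ` K)"
      using compact_almost_feasible[OF I(1)] by (auto simp: K_def intro: compact_scaling)
    show "(*\<^sub>R) s ` K \<noteq> {}"
      using zero_in_feasible[OF \<open>R \<ge> 0\<close>, of a b] I by (auto simp: K_def almost_feasible_def)
  next
    fix p :: "nat \<Rightarrow> real ^ 'd"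
    assume "\<forall>i<n. p i \<in> (*\<^sub>R) s ` K"
    then have "\<forall>i\<in>{..<n}. \<exists>y. y \<in> K \<and> p i = s *\<^sub>R y" by blast
    then obtain q where q: "\<And>i. i < n \<Longrightarrow> q i \<in> K \<and> p i = s *\<^sub>R q i"
      unfolding bchoice_iff by auto
    then obtain m where m: "m \<in> I"
      and sees_q: "\<And>x i. x \<in> Q m \<Longrightarrow> i < n \<Longrightarrow> sees K x (q i)"
      using almost_feasible_common_view[of n q a b R] unfolding I_def K_def Q_def by blast
    \<comment> \<open>\<open>Q m\<close> may be larger than the minimum, so its own factor
      \<open>r\<close> gives volume exactly 1. Since \<open>r \<le> s\<close>, star-shapedness puts
      the result inside the dilate of \<open>Q m\<close> by \<open>s\<close>.\<close>
    define r where "r = root CARD('d) (1 / measure lebesgue (Q m))"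
    have pos: "0 < measure lebesgue (Q m)" using Q_ge[OF m] \<mu> by linarith
    have r: "0 \<le> r" "r ^ CARD('d) = 1 / measure lebesgue (Q m)" "r \<le> s"
      using pos \<mu> Q_ge[OF m] by (simp_all add: r_def s_def frac_le)
    have shrink: "\<exists>y\<in>Q m. r *\<^sub>R x = s *\<^sub>R y" if "x \<in> Q m" for x
    proof
      show "(r / s) *\<^sub>R x \<in> Q m"
        using feasible_scaleR_mem[of x a b R _ "r / s"] that r s(1) by (simp add: Q_def)
      show "r *\<^sub>R x = s *\<^sub>R ((r / s) *\<^sub>R x)" using s(1) by simp
    qed
    have QK: "Q m \<subseteq> K" using m by (auto simp: Q_def K_def almost_feasible_def)
    show "\<exists>X. X \<subseteq> (*\<^sub>R) s ` K \<and> X \<in> lmeasurable \<and> measure lebesgue X = 1 \<and>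
            (\<forall>x\<in>X. \<forall>i<n. sees ((*\<^sub>R) s ` K) x (p i))"
    proof (intro exI[of _ "(*\<^sub>R) r ` Q m"] conjI ballI allI impI)
      show "(*\<^sub>R) r ` Q m \<subseteq> (*\<^sub>R) s ` K" using shrink QK by blast
      show "(*\<^sub>R) r ` Q m \<in> lmeasurable" using comp(2) by (intro lmeasurable_compact compact_scaling)
      show "measure lebesgue ((*\<^sub>R) r ` Q m) = 1"
        using measure_scaleR_image[OF r(1), of "Q m"] r(2) pos by simp
    next
      fix x i assume "x \<in> (*\<^sub>R) r ` Q m" "i < n"
      then obtain y where y: "y \<in> Q m" "x = s *\<^sub>R y" using shrink by blast
      have "sees K y (q i)" using sees_q y(1) \<open>i < n\<close> by blast
      then show "sees ((*\<^sub>R) s ` K) x (p i)"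
        using q[OF \<open>i < n\<close>] y(2) s(1) by (simp add: sees_scaleR)
    qed
  next
    show "\<not> (\<exists>X'. X' \<subseteq> (*\<^sub>R) s ` K \<and> X' \<in> lmeasurable \<and>
        measure lebesgue X' > 1 - (1 - v / \<mu>) \<and>
        (\<forall>x\<in>X'. \<forall>y\<in>(*\<^sub>R) s ` K. sees ((*\<^sub>R) s ` K) x y))"
    proof
      assume "\<exists>X'. X' \<subseteq> (*\<^sub>R) s ` K \<and> X' \<in> lmeasurable \<and>
        measure lebesgue X' > 1 - (1 - v / \<mu>) \<and>
        (\<forall>x\<in>X'. \<forall>y\<in>(*\<^sub>R) s ` K. sees ((*\<^sub>R) s ` K) x y)"
      then obtain X' where X': "X' \<subseteq> (*\<^sub>R) s ` K" "X' \<in> lmeasurable"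
        "measure lebesgue X' > v / \<mu>" "\<forall>x\<in>X'. \<forall>y\<in>(*\<^sub>R) s ` K. sees ((*\<^sub>R) s ` K) x y"
        unfolding diff_diff_eq2 add_diff_cancel_left' by blast
      have "X' \<subseteq> (*\<^sub>R) s ` P"
      proof
        fix x assume "x \<in> X'"
        then obtain y where y: "y \<in> K" "x = s *\<^sub>R y" using X'(1) by auto
        then have "\<forall>z\<in>K. sees K y z"
          using X'(4) \<open>x \<in> X'\<close> s(1) by (auto simp: sees_scaleR)
        then have "y \<in> P"
          using kernel_subset_feasible[OF ab, of "3 * n + 1" R y] n y(1) R
          by (simp add: P_def K_def I_def)
        then show "x \<in> (*\<^sub>R) s ` P" using y(2) by blast
      qed
      then have "measure lebesgue X' \<le> measure lebesgue ((*\<^sub>R) s ` P)"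
        using X'(2) comp(1)
        by (intro measure_mono_fmeasurable lmeasurable_compact compact_scaling) auto
      also have "\<dots> = v / \<mu>"
        using measure_scaleR_image[of s P] s by (simp add: v_def)
      finally show False using X'(3) by simp
    qed
  qed
qed

section \<open>Two separated unit cubes for a single given point\<close>

lemma exists_two_boxes:
  "\<exists>K :: (real ^ 'd) set. compact K \<and> K \<noteq> {} \<and>
     (\<forall>p\<in>K. \<exists>X. X \<subseteq> K \<and> X \<in> lmeasurable \<and> measure lebesgue X = 1 \<and> (\<forall>x\<in>X. sees K x p)) \<and>
     (\<forall>x\<in>K. \<exists>y\<in>K. \<not> sees K x y)"
proof -
  define B :: "real \<Rightarrow> (real ^ 'd) set" where "B t = cbox (vec t) (vec (t + 1))" for t
  have B_mem: "x \<in> B t \<longleftrightarrow> (\<forall>i. t \<le> x $ i \<and> x $ i \<le> t + 1)" for x t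
    by (simp add: B_def mem_box_cart)
  have vec_mem: "vec t \<in> B t" for t by (simp add: B_mem)
  define K where "K = B 0 \<union> B 3"
  have B: "convex (B t)" "B t \<in> lmeasurable" "measure lebesgue (B t) = 1" for t
    by (auto simp: B_def content_cbox_if_cart interval_eq_empty_cart)
  \<comment> \<open>Points of different cubes have a midpoint with all coordinates between
    \<open>3/2\<close> and \<open>5/2\<close>, inside the gap.\<close>
  have blocked: "\<not> sees K x y" if "x \<in> B s" "y \<in> B t" "s + t = 3" for x y s t
  proof
    assume "sees K x y"
    then have "midpoint x y \<in> K" by (auto simp: sees_def)
    then obtain i where "midpoint x y $ i \<le> 1 \<or> 3 \<le> midpoint x y $ i"
      by (auto simp: K_def B_mem)
    moreover have "midpoint x y $ i = (x $ i + y $ i) / 2"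
      by (simp add: midpoint_def)
    ultimately show False using that by (auto simp: B_mem dest!: spec[of _ i])
  qed
  show ?thesis
  proof (rule exI[of _ K], intro conjI ballI)
    show "compact K" by (auto simp: K_def B_def)
    show "K \<noteq> {}" using vec_mem by (auto simp: K_def)
  next
    fix p assume "p \<in> K"
    then obtain t where t: "p \<in> B t" "B t \<subseteq> K" by (auto simp: K_def)
    then have "\<forall>x\<in>B t. sees K x p"
      using closed_segment_subset[OF _ _ B(1)] unfolding sees_def by blast
    then show "\<exists>X. X \<subseteq> K \<and> X \<in> lmeasurable \<and> measure lebesgue X = 1 \<and> (\<forall>x\<in>X. sees K x p)"
      using t(2) B(2,3) by (intro exI[of _ "B t"]) simp
  next
    fix x assume "x \<in> K"
    then show "\<exists>y\<in>K. \<not> sees K x y"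
      using blocked[of x 0 _ 3] blocked[of x 3 _ 0] vec_mem by (auto simp: K_def)
  qed
qed

theorem theorem1p4:
  fixes n :: nat
  assumes "n \<ge> 1"
  shows "\<exists>(\<epsilon>::real) (K :: (real ^ 'd) set).
           \<epsilon> > 0 \<and> compact K \<and>
           (CARD('d) \<ge> 2 \<or> n = 1 \<longrightarrow> K \<noteq> {}) \<and>
           (\<forall>p :: nat \<Rightarrow> real ^ 'd. (\<forall>i<n. p i \<in> K) \<longrightarrow>
              (\<exists>X. X \<subseteq> K \<and> X \<in> lmeasurable \<and> measure lebesgue X = 1 \<and>
                   (\<forall>x\<in>X. \<forall>i<n. sees K x (p i)))) \<and>
           \<not> (\<exists>X'. X' \<subseteq> K \<and> X' \<in> lmeasurable \<and> measure lebesgue X' > 1 - \<epsilon> \<and>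
                   (\<forall>x\<in>X'. \<forall>y\<in>K. sees K x y))"
proof -
  consider "CARD('d) \<ge> 2" | "n = 1" | "\<not> CARD('d) \<ge> 2" "n \<noteq> 1" by blast
  then show ?thesis
  proof cases
    case 1
    then have "\<not> CARD('d) \<le> Suc 0" by simp
    then obtain a b :: 'd where "a \<noteq> b"
      using card_le_Suc0_iff_eq[of "UNIV :: 'd set"] by auto
    from exists_volume_gap[OF this assms] show ?thesis by blast
  next
    case 2
    obtain K :: "(real ^ 'd) set" where K: "compact K" "K \<noteq> {}"
      "\<forall>p\<in>K. \<exists>X. X \<subseteq> K \<and> X \<in> lmeasurable \<and> measure lebesgue X = 1 \<and> (\<forall>x\<in>X. sees K x p)"
      "\<forall>x\<in>K. \<exists>y\<in>K. \<not> sees K x y"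
      using exists_two_boxes by blast
    \<comment> \<open>With \<open>\<epsilon> = 1\<close> only positive volume has to be excluded,
      and no point sees all of \<open>K\<close>.\<close>
    have no_kernel: "\<not> (\<exists>X'. X' \<subseteq> K \<and> X' \<in> lmeasurable \<and> measure lebesgue X' > 1 - 1 \<and>
                   (\<forall>x\<in>X'. \<forall>y\<in>K. sees K x y))"
    proof
      assume "\<exists>X'. X' \<subseteq> K \<and> X' \<in> lmeasurable \<and> measure lebesgue X' > 1 - 1 \<and>
                   (\<forall>x\<in>X'. \<forall>y\<in>K. sees K x y)"
      then obtain X' where X': "X' \<subseteq> K" "measure lebesgue X' > 0" "\<forall>x\<in>X'. \<forall>y\<in>K. sees K x y"
        by auto
      then have "X' = {}" using K(4) by blast
      with X'(2) show False by simp
    qed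
    show ?thesis
      using K(1-3) no_kernel 2 by (intro exI[of _ "1::real"] exI[of _ K]) (simp add: less_Suc0)
  next
    case 3
    \<comment> \<open>For empty \<open>K\<close> the premise on \<open>p\<close> fails at index
      \<open>0 < n\<close>, and \<open>\<epsilon> = 1\<close> would demand a subset of positive
      volume.\<close>
    then show ?thesis
      using assms by (intro exI[of _ "1::real"] exI[of _ "{} :: (real ^ 'd) set"]) (auto intro: exI[of _ 0])
  qed
qed

end
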